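(* If a formula $\phi$ is FMA-valid, then $\phi$ is a theorem of $\mathbf{MP}$.
   Context: Formulas: built from a countable set $\mathsf{A}$ of atomic formulas (containing $\top,\bot$) by $\land,\neg,\Box,\mathsf{K}$ ($\lor$ as usual). The system $\mathbf{MP}$ has rules modus ponens, $\mathsf{K}$-necessitation ($\phi/\mathsf{K}\phi$), $\Box$-necessitation ($\phi/\Box\phi$) and axioms all instances of: (1) propositional tautologies; (2) $(A\to\Box A)\land(\neg A\to\Box\neg A)$ for atomic $A$; (3) $\Box(\phi\to\psi)\to(\Box\phi\to\Box\psi)$; (4) $\Box\phi\to\phi$; (5) $\Box\phi\to\Box\Box\phi$; (6) $\mathsf{K}(\phi\to\psi)\to(\mathsf{K}\phi\to\mathsf{K}\psi)$; (7) $\mathsf{K}\phi\to\phi$; (8) $\mathsf{K}\phi\to\mathsf{K}\mathsf{K}\phi$; (9) $\phi\to\mathsf{K}\mathsf{L}\phi$ where $\mathsf{L}=\neg\mathsf{K}\neg$; (10) $\mathsf{K}\Box\phi\to\Box\mathsf{K}\phi$. On a Boolean algebra $\langle B,\mathbf{0},\mathbf{1},-,\cap,\cup\rangle$: an interior operator $I$ satisfies $I(a\cap b)=Ia\cap Ib$, $Ia\le a$, $IIa=Ia$, $I\mathbf{1}=\mathbf{1}$, with dual $C=-I-$; a universal quantifier $\forall$ satisfies $\forall(a\cup\forall b)=\forall a\cup\forall b$, $\forall a\le a$, $\forall\mathbf{1}=\mathbf{1}$. $B^I=\{a: a\le Ia\}\cap\{a: Ca\le a\}$. A fixed monadic algebra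 (FMA) is a Boolean algebra with an interior operator $I$ and a universal quantifier $\forall$ such that $\forall Ia\ge I\forall a$ for all $a$. A valuation on an FMA is a map $v$ from formulas to $B$ with $v(A)\in B^I$ for atomic $A$, $v(\neg\phi)=-v(\phi)$, $v(\phi\land\psi)=v(\phi)\cap v(\psi)$, $v(\phi\lor\psi)=v(\phi)\cup v(\psi)$, $v(\Box\phi)=Iv(\phi)$, $v(\mathsf{K}\phi)=\forall v(\phi)$. A formula is FMA-valid if $v(\phi)=\mathbf{1}$ for every valuation $v$ on every FMA.
   Formalization: The FMA condition is taken as ∀Ia ≤ I∀a (matching axiom (10)) instead of the printed ∀Ia ≥ I∀a, under which the claim fails: □KLp → K□Lp would be FMA-valid but is not a theorem of MP. *)

theory Defs
  imports Main "HOL-Library.Countable"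
begin

datatype 'p atm = Verum | Falsum | Var 'p

datatype 'p fm =
    Atom "'p atm"
  | Conj "'p fm" "'p fm"
  | Neg "'p fm"
  | Box "'p fm"
  | Know "'p fm"

abbreviation Disj :: "'p fm \<Rightarrow> 'p fm \<Rightarrow> 'p fm" where
  "Disj \<phi> \<psi> \<equiv> Neg (Conj (Neg \<phi>) (Neg \<psi>))"

abbreviation Imp :: "'p fm \<Rightarrow> 'p fm \<Rightarrow> 'p fm" where
  "Imp \<phi> \<psi> \<equiv> Neg (Conj \<phi> (Neg \<psi>))"

abbreviation Poss :: "'p fm \<Rightarrow> 'p fm" where
  "Poss \<phi> \<equiv> Neg (Know (Neg \<phi>))"

(* Truth value when variables and formulas of the form Box or Know are
   treated as propositional letters, with truth values given by g. *)
primrec bool_eval :: "('p fm \<Rightarrow> bool) \<Rightarrow> 'p fm \<Rightarrow> bool" where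
  "bool_eval g (Atom a) = (case a of Verum \<Rightarrow> True | Falsum \<Rightarrow> False | Var p \<Rightarrow> g (Atom a))"
| "bool_eval g (Conj \<phi> \<psi>) = (bool_eval g \<phi> \<and> bool_eval g \<psi>)"
| "bool_eval g (Neg \<phi>) = (\<not> bool_eval g \<phi>)"
| "bool_eval g (Box \<phi>) = g (Box \<phi>)"
| "bool_eval g (Know \<phi>) = g (Know \<phi>)"

definition tautology :: "'p fm \<Rightarrow> bool" where
  "tautology \<phi> \<longleftrightarrow> (\<forall>g. bool_eval g \<phi>)"

inductive MP :: "'p fm \<Rightarrow> bool" where
  taut: "tautology \<phi> \<Longrightarrow> MP \<phi>"
| atomic: "MP (Conj (Imp (Atom a) (Box (Atom a))) (Imp (Neg (Atom a)) (Box (Neg (Atom a)))))"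
| Box_K: "MP (Imp (Box (Imp \<phi> \<psi>)) (Imp (Box \<phi>) (Box \<psi>)))"
| Box_T: "MP (Imp (Box \<phi>) \<phi>)"
| Box_4: "MP (Imp (Box \<phi>) (Box (Box \<phi>)))"
| Know_K: "MP (Imp (Know (Imp \<phi> \<psi>)) (Imp (Know \<phi>) (Know \<psi>)))"
| Know_T: "MP (Imp (Know \<phi>) \<phi>)"
| Know_4: "MP (Imp (Know \<phi>) (Know (Know \<phi>)))"
| Know_B: "MP (Imp \<phi> (Know (Poss \<phi>)))"
| cross: "MP (Imp (Know (Box \<phi>)) (Box (Know \<phi>)))"
| modus_ponens: "MP (Imp \<phi> \<psi>) \<Longrightarrow> MP \<phi> \<Longrightarrow> MP \<psi>"
| Know_nec: "MP \<phi> \<Longrightarrow> MP (Know \<phi>)"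
| Box_nec: "MP \<phi> \<Longrightarrow> MP (Box \<phi>)"

record 'b bool_alg =
  carrier :: "'b set"
  bzero :: 'b (\<open>\<zero>\<index>\<close>)
  bone :: 'b (\<open>\<one>\<index>\<close>)
  bcompl :: "'b \<Rightarrow> 'b" (\<open>\<sim>\<index> _\<close> [81] 80)
  bmeet :: "'b \<Rightarrow> 'b \<Rightarrow> 'b" (infixl \<open>\<sqinter>\<index>\<close> 70)
  bjoin :: "'b \<Rightarrow> 'b \<Rightarrow> 'b" (infixl \<open>\<squnion>\<index>\<close> 65)

record 'b fm_alg = "'b bool_alg" +
  interior_op :: "'b \<Rightarrow> 'b" (\<open>\<I>\<index>\<close>)
  univ_op :: "'b \<Rightarrow> 'b" (\<open>\<A>\<index>\<close>)

definition ble :: "('b, 'm) bool_alg_scheme \<Rightarrow> 'b \<Rightarrow> 'b \<Rightarrow> bool" (infix \<open>\<sqsubseteq>\<index>\<close> 50) where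
  "a \<sqsubseteq>\<^bsub>B\<^esub> b \<longleftrightarrow> a \<sqinter>\<^bsub>B\<^esub> b = a"

(* The axioms of the library's abstract_boolean_algebra, relativised to a carrier. *)
locale bool_algebra_on =
  fixes B :: "('b, 'm) bool_alg_scheme" (structure)
  assumes zero_closed: "\<zero> \<in> carrier B"
    and one_closed: "\<one> \<in> carrier B"
    and compl_closed: "a \<in> carrier B \<Longrightarrow> \<sim> a \<in> carrier B"
    and meet_closed: "\<lbrakk>a \<in> carrier B; b \<in> carrier B\<rbrakk> \<Longrightarrow> a \<sqinter> b \<in> carrier B"
    and join_closed: "\<lbrakk>a \<in> carrier B; b \<in> carrier B\<rbrakk> \<Longrightarrow> a \<squnion> b \<in> carrier B"
    and meet_assoc: "\<lbrakk>a \<in> carrier B; b \<in> carrier B; c \<in> carrier B\<rbrakk> \<Longrightarrow> (a \<sqinter> b) \<sqinter> c = a \<sqinter> (b \<sqinter> c)"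
    and join_assoc: "\<lbrakk>a \<in> carrier B; b \<in> carrier B; c \<in> carrier B\<rbrakk> \<Longrightarrow> (a \<squnion> b) \<squnion> c = a \<squnion> (b \<squnion> c)"
    and meet_commute: "\<lbrakk>a \<in> carrier B; b \<in> carrier B\<rbrakk> \<Longrightarrow> a \<sqinter> b = b \<sqinter> a"
    and join_commute: "\<lbrakk>a \<in> carrier B; b \<in> carrier B\<rbrakk> \<Longrightarrow> a \<squnion> b = b \<squnion> a"
    and meet_join_distrib:
      "\<lbrakk>a \<in> carrier B; b \<in> carrier B; c \<in> carrier B\<rbrakk> \<Longrightarrow> a \<sqinter> (b \<squnion> c) = (a \<sqinter> b) \<squnion> (a \<sqinter> c)"
    and join_meet_distrib:
      "\<lbrakk>a \<in> carrier B; b \<in> carrier B; c \<in> carrier B\<rbrakk> \<Longrightarrow> a \<squnion> (b \<sqinter> c) = (a \<squnion> b) \<sqinter> (a \<squnion> c)"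
    and meet_one: "a \<in> carrier B \<Longrightarrow> a \<sqinter> \<one> = a"
    and join_zero: "a \<in> carrier B \<Longrightarrow> a \<squnion> \<zero> = a"
    and meet_compl: "a \<in> carrier B \<Longrightarrow> a \<sqinter> \<sim> a = \<zero>"
    and join_compl: "a \<in> carrier B \<Longrightarrow> a \<squnion> \<sim> a = \<one>"

definition interior_operator :: "('b, 'm) bool_alg_scheme \<Rightarrow> ('b \<Rightarrow> 'b) \<Rightarrow> bool" where
  "interior_operator B J \<longleftrightarrow>
     (\<forall>a \<in> carrier B. J a \<in> carrier B) \<and>
     (\<forall>a \<in> carrier B. \<forall>b \<in> carrier B. J (a \<sqinter>\<^bsub>B\<^esub> b) = J a \<sqinter>\<^bsub>B\<^esub> J b) \<and>
     (\<forall>a \<in> carrier B. J a \<sqsubseteq>\<^bsub>B\<^esub> a) \<and>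
     (\<forall>a \<in> carrier B. J (J a) = J a) \<and>
     J \<one>\<^bsub>B\<^esub> = \<one>\<^bsub>B\<^esub>"

definition universal_quantifier :: "('b, 'm) bool_alg_scheme \<Rightarrow> ('b \<Rightarrow> 'b) \<Rightarrow> bool" where
  "universal_quantifier B Q \<longleftrightarrow>
     (\<forall>a \<in> carrier B. Q a \<in> carrier B) \<and>
     (\<forall>a \<in> carrier B. \<forall>b \<in> carrier B. Q (a \<squnion>\<^bsub>B\<^esub> Q b) = Q a \<squnion>\<^bsub>B\<^esub> Q b) \<and>
     (\<forall>a \<in> carrier B. Q a \<sqsubseteq>\<^bsub>B\<^esub> a) \<and>
     Q \<one>\<^bsub>B\<^esub> = \<one>\<^bsub>B\<^esub>"

(* The inequality is the algebraic form of axiom cross.  The source prints it with its sides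
   exchanged; completeness is false for that class of algebras: it validates
   Imp (Box (Know (Poss p))) (Know (Box (Poss p))), which is not a theorem of MP, as it fails
   in the subset space with points x, y, opens {x,y}, {x}, {y} and p true exactly at x. *)
locale fma = bool_algebra_on B for B :: "('b, 'm) fm_alg_scheme" (structure) +
  assumes interior: "interior_operator B \<I>"
    and quantifier: "universal_quantifier B \<A>"
    and fixed: "a \<in> carrier B \<Longrightarrow> \<A> (\<I> a) \<sqsubseteq> \<I> (\<A> a)"

definition closure_op :: "('b, 'm) fm_alg_scheme \<Rightarrow> 'b \<Rightarrow> 'b" where
  "closure_op B a = \<sim>\<^bsub>B\<^esub> (\<I>\<^bsub>B\<^esub> (\<sim>\<^bsub>B\<^esub> a))"

definition fixed_elements :: "('b, 'm) fm_alg_scheme \<Rightarrow> 'b set" where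
  "fixed_elements B =
     {a \<in> carrier B. a \<sqsubseteq>\<^bsub>B\<^esub> \<I>\<^bsub>B\<^esub> a} \<inter> {a \<in> carrier B. closure_op B a \<sqsubseteq>\<^bsub>B\<^esub> a}"

locale fma_valuation = fma B for B :: "('b, 'm) fm_alg_scheme" (structure) +
  fixes v :: "'p fm \<Rightarrow> 'b"
  assumes v_closed: "v \<phi> \<in> carrier B"
    and v_Atom: "v (Atom a) \<in> fixed_elements B"
    and v_Verum: "v (Atom Verum) = \<one>"
    and v_Falsum: "v (Atom Falsum) = \<zero>"
    and v_Neg: "v (Neg \<phi>) = \<sim> (v \<phi>)"
    and v_Conj: "v (Conj \<phi> \<psi>) = v \<phi> \<sqinter> v \<psi>"
    and v_Disj: "v (Disj \<phi> \<psi>) = v \<phi> \<squnion> v \<psi>"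
    and v_Box: "v (Box \<phi>) = \<I> (v \<phi>)"
    and v_Know: "v (Know \<phi>) = \<A> (v \<phi>)"

(* HOL cannot quantify over all types inside a formula, so validity is relative to the
   type 'b from which the carriers (arbitrary subsets of 'b) are drawn. *)
definition fma_valid :: "'b itself \<Rightarrow> 'p fm \<Rightarrow> bool" where
  "fma_valid TYPE('b) \<phi> \<longleftrightarrow>
     (\<forall>(B :: 'b fm_alg) v. fma_valuation B v \<longrightarrow> v \<phi> = \<one>\<^bsub>B\<^esub>)"

end

theory Submission
  imports Defs
begin

text \<open>
  The Lindenbaum algebra of \<open>MP\<close>, formulas modulo provable equivalence, is an FMA in which the
  quotient map is a valuation sending a formula to the unit only if it is a theorem.  There are
  countably many formulas, so this algebra has an isomorphic copy inside any infinite type \<open>'b\<close>.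
\<close>

instance atm :: (countable) countable
  by countable_datatype

instance fm :: (countable) countable
  by countable_datatype

text \<open>Together with \<open>MP_conseq1\<close> and \<open>MP_conseq2\<close>, this replaces
  propositional derivations by a check over all \<open>g\<close>, in which formulas
  \<open>Box\<close> and \<open>Know\<close> count as letters. Later proofs only have to supply the
  modal premises.\<close>

lemma MP_conseq0: "(\<And>g. bool_eval g \<phi>) \<Longrightarrow> MP \<phi>"
  by (simp add: MP.taut tautology_def)

lemma MP_Verum: "MP (Atom Verum)"
  by (rule MP_conseq0) simp

lemma MP_conseq1:
  assumes "MP \<alpha>" and "\<And>g. bool_eval g \<alpha> \<Longrightarrow> bool_eval g \<phi>"
  shows "MP \<phi>"
proof -
  have "MP (Imp \<alpha> \<phi>)"
    using assms(2) by (intro MP_conseq0) auto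
  then show ?thesis
    using assms(1) by (rule MP.modus_ponens)
qed

lemma MP_conseq2:
  assumes "MP \<alpha>" and "MP \<beta>" and "\<And>g. bool_eval g \<alpha> \<Longrightarrow> bool_eval g \<beta> \<Longrightarrow> bool_eval g \<phi>"
  shows "MP \<phi>"
proof -
  have "MP (Imp \<beta> \<phi>)"
    using assms(1) by (rule MP_conseq1) (use assms(3) in auto)
  then show ?thesis
    using assms(2) by (rule MP.modus_ponens)
qed

lemma MP_Imp_trans: "MP (Imp \<phi> \<psi>) \<Longrightarrow> MP (Imp \<psi> \<chi>) \<Longrightarrow> MP (Imp \<phi> \<chi>)"
  by (erule (1) MP_conseq2) auto

lemma Box_mono: "MP (Imp \<phi> \<psi>) \<Longrightarrow> MP (Imp (Box \<phi>) (Box \<psi>))"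
  by (rule MP.modus_ponens[OF MP.Box_K MP.Box_nec])

lemma Know_mono: "MP (Imp \<phi> \<psi>) \<Longrightarrow> MP (Imp (Know \<phi>) (Know \<psi>))"
  by (rule MP.modus_ponens[OF MP.Know_K MP.Know_nec])

definition prov_equiv :: "'p fm \<Rightarrow> 'p fm \<Rightarrow> bool" where
  "prov_equiv \<phi> \<psi> \<longleftrightarrow> MP (Imp \<phi> \<psi>) \<and> MP (Imp \<psi> \<phi>)"

lemma prov_equiv_taut: "(\<And>g. bool_eval g \<phi> = bool_eval g \<psi>) \<Longrightarrow> prov_equiv \<phi> \<psi>"
  unfolding prov_equiv_def by (auto intro!: MP_conseq0)

lemma prov_equiv_refl: "prov_equiv \<phi> \<phi>"
  by (rule prov_equiv_taut) (rule refl)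

lemma prov_equiv_sym: "prov_equiv \<phi> \<psi> \<Longrightarrow> prov_equiv \<psi> \<phi>"
  unfolding prov_equiv_def by blast

lemma prov_equiv_trans: "prov_equiv \<phi> \<psi> \<Longrightarrow> prov_equiv \<psi> \<chi> \<Longrightarrow> prov_equiv \<phi> \<chi>"
  unfolding prov_equiv_def by (blast intro: MP_Imp_trans)

lemma MP_contrapos: "MP (Imp \<phi> \<psi>) \<Longrightarrow> MP (Imp (Neg \<psi>) (Neg \<phi>))"
  by (erule MP_conseq1) auto

lemma prov_equiv_Neg: "prov_equiv \<phi> \<psi> \<Longrightarrow> prov_equiv (Neg \<phi>) (Neg \<psi>)"
  unfolding prov_equiv_def by (blast intro: MP_contrapos)

lemma prov_equiv_Conj:
  assumes "prov_equiv \<phi> \<phi>'" and "prov_equiv \<psi> \<psi>'"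
  shows "prov_equiv (Conj \<phi> \<psi>) (Conj \<phi>' \<psi>')"
proof -
  have "MP (Imp (Conj \<alpha> \<beta>) (Conj \<alpha>' \<beta>'))" if "MP (Imp \<alpha> \<alpha>')" "MP (Imp \<beta> \<beta>')"
    for \<alpha> \<alpha>' \<beta> \<beta>' :: "'a fm"
    by (rule MP_conseq2[OF that]) auto
  then show ?thesis
    using assms unfolding prov_equiv_def by blast
qed

lemma prov_equiv_Box: "prov_equiv \<phi> \<psi> \<Longrightarrow> prov_equiv (Box \<phi>) (Box \<psi>)"
  unfolding prov_equiv_def by (blast intro: Box_mono)

lemma prov_equiv_Know: "prov_equiv \<phi> \<psi> \<Longrightarrow> prov_equiv (Know \<phi>) (Know \<psi>)"
  unfolding prov_equiv_def by (blast intro: Know_mono)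

text \<open>The order \<open>ble\<close> is defined through the meet, so this is what turns the
  order of the Lindenbaum algebra into provable implication.\<close>

lemma prov_equiv_Conj_left_iff: "prov_equiv (Conj \<phi> \<psi>) \<phi> \<longleftrightarrow> MP (Imp \<phi> \<psi>)"
proof
  assume "prov_equiv (Conj \<phi> \<psi>) \<phi>"
  then have "MP (Imp \<phi> (Conj \<phi> \<psi>))"
    unfolding prov_equiv_def ..
  then show "MP (Imp \<phi> \<psi>)"
    by (rule MP_conseq1) auto
next
  assume "MP (Imp \<phi> \<psi>)"
  then have "MP (Imp \<phi> (Conj \<phi> \<psi>))"
    by (rule MP_conseq1) auto
  moreover have "MP (Imp (Conj \<phi> \<psi>) \<phi>)"
    by (rule MP_conseq0) auto
  ultimately show "prov_equiv (Conj \<phi> \<psi>) \<phi>"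
    unfolding prov_equiv_def by blast
qed

lemma Box_Conj: "prov_equiv (Box (Conj \<phi> \<psi>)) (Conj (Box \<phi>) (Box \<psi>))"
proof -
  have "MP (Imp (Box (Conj \<phi> \<psi>)) (Box \<phi>))" "MP (Imp (Box (Conj \<phi> \<psi>)) (Box \<psi>))"
    by (rule Box_mono, rule MP_conseq0, simp)+
  then have "MP (Imp (Box (Conj \<phi> \<psi>)) (Conj (Box \<phi>) (Box \<psi>)))"
    by (rule MP_conseq2) auto
  \<comment> \<open>Currying: pairing is a tautology when read as a nested implication, and
    \<open>Box_K\<close> then distributes the inner \<open>Box\<close>.\<close>
  moreover have "MP (Imp (Box \<phi>) (Box (Imp \<psi> (Conj \<phi> \<psi>))))"
    by (rule Box_mono, rule MP_conseq0) auto
  then have "MP (Imp (Conj (Box \<phi>) (Box \<psi>)) (Box (Conj \<phi> \<psi>)))"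
    using MP.Box_K by (rule MP_conseq2) auto
  ultimately show ?thesis
    unfolding prov_equiv_def by blast
qed

lemma Box_Box: "prov_equiv (Box (Box \<phi>)) (Box \<phi>)"
  unfolding prov_equiv_def by (blast intro: MP.Box_T MP.Box_4)

text \<open>Both sides are provable by necessitation. Applied to \<open>Verum\<close>, this gives
  the unit law of the interior operator, as \<open>Know_theorem\<close> does for the
  quantifier.\<close>

lemma Box_theorem: "MP \<phi> \<Longrightarrow> prov_equiv (Box \<phi>) \<phi>"
  unfolding prov_equiv_def by (auto intro: MP.Box_T MP_conseq1[OF MP.Box_nec])

lemma Know_theorem: "MP \<phi> \<Longrightarrow> prov_equiv (Know \<phi>) \<phi>"
  unfolding prov_equiv_def by (auto intro: MP.Know_T MP_conseq1[OF MP.Know_nec])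

text \<open>Negative introspection from B and 4: \<open>Know_B\<close> at
  \<open>Neg (Know \<phi>)\<close> puts a \<open>Poss\<close> under the outer \<open>Know\<close>,
  and the contrapositive of \<open>Know_4\<close> removes it.\<close>

lemma Know_5: "MP (Imp (Neg (Know \<phi>)) (Know (Neg (Know \<phi>))))"
proof -
  have "MP (Imp (Know (Know \<phi>)) (Know (Neg (Neg (Know \<phi>)))))"
    by (rule Know_mono, rule MP_conseq0) auto
  with MP.Know_4 have "MP (Imp (Know \<phi>) (Know (Neg (Neg (Know \<phi>)))))"
    by (rule MP_Imp_trans)
  then have "MP (Imp (Poss (Neg (Know \<phi>))) (Neg (Know \<phi>)))"
    by (rule MP_conseq1) auto
  then have "MP (Imp (Know (Poss (Neg (Know \<phi>)))) (Know (Neg (Know \<phi>))))"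
    by (rule Know_mono)
  with MP.Know_B show ?thesis
    by (rule MP_Imp_trans)
qed

text \<open>From left to right, read the disjunction as an implication from
  \<open>Neg (Know \<psi>)\<close> and distribute \<open>Know\<close>; \<open>Know_5\<close> turns
  the resulting premise \<open>Know (Neg (Know \<psi>))\<close> back into
  \<open>Neg (Know \<psi>)\<close>. The converse is monotonicity, with \<open>Know_4\<close> for the
  second disjunct.\<close>

lemma Know_Disj_Know: "prov_equiv (Know (Disj \<phi> (Know \<psi>))) (Disj (Know \<phi>) (Know \<psi>))"
proof -
  let ?\<delta> = "Disj \<phi> (Know \<psi>)"
  have "MP (Imp (Know ?\<delta>) (Know (Imp (Neg (Know \<psi>)) \<phi>)))"
    by (rule Know_mono, rule MP_conseq0) auto
  then have "MP (Imp (Know ?\<delta>) (Imp (Know (Neg (Know \<psi>))) (Know \<phi>)))"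
    using MP.Know_K by (rule MP_Imp_trans)
  with Know_5[of \<psi>] have "MP (Imp (Know ?\<delta>) (Disj (Know \<phi>) (Know \<psi>)))"
    by (rule MP_conseq2) auto
  moreover have "MP (Imp (Know (Know \<psi>)) (Know ?\<delta>))"
    by (rule Know_mono, rule MP_conseq0) auto
  with MP.Know_4 have "MP (Imp (Know \<psi>) (Know ?\<delta>))"
    by (rule MP_Imp_trans)
  moreover have "MP (Imp (Know \<phi>) (Know ?\<delta>))"
    by (rule Know_mono, rule MP_conseq0) auto
  ultimately show ?thesis
    unfolding prov_equiv_def by (auto elim: MP_conseq2)
qed

text \<open>Instead of a quotient type, any map into \<open>'b\<close> whose kernel is provable
  equivalence stands in for the quotient map. Thus the algebra lives inside the type over which
  validity ranges.\<close>

locale lindenbaum =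
  fixes v :: "'p fm \<Rightarrow> 'b"
  assumes v_eq_iff: "v \<phi> = v \<psi> \<longleftrightarrow> prov_equiv \<phi> \<psi>"
begin

text \<open>Outside \<open>range v\<close> the value is arbitrary, which is harmless because the
  algebra laws are relativised to the carrier.\<close>

definition rep :: "'b \<Rightarrow> 'p fm" where
  "rep b = (SOME \<phi>. v \<phi> = b)"

lemma prov_equiv_rep: "prov_equiv (rep (v \<phi>)) \<phi>"
  unfolding rep_def v_eq_iff[symmetric] by (rule someI) (rule refl)

definition alg :: "'b fm_alg" where
  "alg = \<lparr>carrier = range v,
     bzero = v (Atom Falsum),
     bone = v (Atom Verum),
     bcompl = (\<lambda>a. v (Neg (rep a))),
     bmeet = (\<lambda>a b. v (Conj (rep a) (rep b))),
     bjoin = (\<lambda>a b. v (Disj (rep a) (rep b))),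
     interior_op = (\<lambda>a. v (Box (rep a))),
     univ_op = (\<lambda>a. v (Know (rep a)))\<rparr>"

text \<open>The operations do not depend on the chosen representatives, because
  \<open>prov_equiv\<close> is a congruence. From here on \<open>rep\<close> is no longer
  needed.\<close>

lemma alg_simps:
  "carrier alg = range v"
  "\<zero>\<^bsub>alg\<^esub> = v (Atom Falsum)"
  "\<one>\<^bsub>alg\<^esub> = v (Atom Verum)"
  "\<sim>\<^bsub>alg\<^esub> (v \<phi>) = v (Neg \<phi>)"
  "v \<phi> \<sqinter>\<^bsub>alg\<^esub> v \<psi> = v (Conj \<phi> \<psi>)"
  "v \<phi> \<squnion>\<^bsub>alg\<^esub> v \<psi> = v (Disj \<phi> \<psi>)"
  "\<I>\<^bsub>alg\<^esub> (v \<phi>) = v (Box \<phi>)"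
  "\<A>\<^bsub>alg\<^esub> (v \<phi>) = v (Know \<phi>)"
  by (simp_all add: alg_def v_eq_iff prov_equiv_Neg prov_equiv_Conj prov_equiv_Box
      prov_equiv_Know prov_equiv_rep)

lemma ble_alg_iff: "v \<phi> \<sqsubseteq>\<^bsub>alg\<^esub> v \<psi> \<longleftrightarrow> MP (Imp \<phi> \<psi>)"
  by (simp add: ble_def alg_simps v_eq_iff prov_equiv_Conj_left_iff)

text \<open>Under \<open>v_eq_iff\<close> each Boolean identity becomes a propositional equivalence,
  which truth values settle.\<close>

lemma bool_algebra_on_alg: "bool_algebra_on alg"
  by unfold_locales (auto simp: alg_simps v_eq_iff intro!: prov_equiv_taut)

lemma interior_operator_alg: "interior_operator alg \<I>\<^bsub>alg\<^esub>"
  unfolding interior_operator_def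
  by (auto simp: alg_simps ble_alg_iff v_eq_iff
      intro: Box_Conj MP.Box_T Box_Box Box_theorem MP_Verum)

lemma universal_quantifier_alg: "universal_quantifier alg \<A>\<^bsub>alg\<^esub>"
  unfolding universal_quantifier_def
  by (auto simp: alg_simps ble_alg_iff v_eq_iff
      intro: Know_Disj_Know MP.Know_T Know_theorem MP_Verum)

lemma fma_alg: "fma alg"
proof -
  interpret bool_algebra_on alg
    by (rule bool_algebra_on_alg)
  show ?thesis
    by unfold_locales
      (auto simp: interior_operator_alg universal_quantifier_alg alg_simps(1,7,8) ble_alg_iff
        intro: MP.cross)
qed

lemma v_Atom_fixed: "v (Atom a) \<in> fixed_elements alg"
proof -
  \<comment> \<open>The second formula, the contrapositive of the second half of
    \<open>atomic\<close>, says that the closure of \<open>v (Atom a)\<close> lies below it.\<close>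
  have "MP (Imp (Atom a) (Box (Atom a)))" "MP (Imp (Neg (Box (Neg (Atom a)))) (Atom a))"
    by (rule MP_conseq1[OF MP.atomic[of a]], force)+
  then show ?thesis
    by (simp add: fixed_elements_def closure_op_def alg_simps ble_alg_iff)
qed

lemma fma_valuation_alg: "fma_valuation alg v"
proof -
  interpret fma alg
    by (rule fma_alg)
  show ?thesis
    by unfold_locales (simp_all add: alg_simps v_Atom_fixed)
qed

lemma v_eq_one_imp_MP: "v \<phi> = \<one>\<^bsub>alg\<^esub> \<Longrightarrow> MP \<phi>"
  unfolding alg_simps v_eq_iff prov_equiv_def by (auto elim: MP_conseq1)

end

lemma ex_lindenbaum:
  assumes "infinite (UNIV :: 'b set)"
  shows "\<exists>v :: 'p :: countable fm \<Rightarrow> 'b. lindenbaum v"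
proof -
  obtain f :: "nat \<Rightarrow> 'b" where f: "inj f"
    using assms infinite_countable_subset by blast
  \<comment> \<open>A class is coded by one chosen member, and the injective maps
    \<open>to_nat\<close> and \<open>f\<close> keep distinct members apart.\<close>
  define v where "v \<phi> = f (to_nat (SOME \<psi>. prov_equiv \<phi> \<psi>))" for \<phi> :: "'p fm"
  have "v \<phi> = v \<psi> \<longleftrightarrow> prov_equiv \<phi> \<psi>" for \<phi> \<psi>
  proof
    have some: "prov_equiv \<chi> (SOME \<xi>. prov_equiv \<chi> \<xi>)" for \<chi> :: "'p fm"
      by (rule someI) (rule prov_equiv_refl)
    assume "v \<phi> = v \<psi>"
    then have "(SOME \<xi>. prov_equiv \<phi> \<xi>) = (SOME \<xi>. prov_equiv \<psi> \<xi>)"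
      using f by (simp add: v_def inj_eq)
    then show "prov_equiv \<phi> \<psi>"
      using some[of \<phi>] some[of \<psi>] prov_equiv_sym prov_equiv_trans by metis
  next
    assume "prov_equiv \<phi> \<psi>"
    \<comment> \<open>As the predicates are equal, and not merely both satisfiable,
      \<open>SOME\<close> picks the same formula for both.\<close>
    then have "prov_equiv \<phi> = prov_equiv \<psi>"
      using prov_equiv_sym prov_equiv_trans by blast
    then show "v \<phi> = v \<psi>"
      by (simp add: v_def)
  qed
  then show ?thesis
    unfolding lindenbaum_def by blast
qed

theorem mainTheorem18:
  fixes \<phi> :: "'p :: countable fm"
  assumes "infinite (UNIV :: 'b set)"
    and "fma_valid TYPE('b) \<phi>"
  shows "MP \<phi>"
proof -
  obtain v :: "'p fm \<Rightarrow> 'b" where "lindenbaum v"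
    using ex_lindenbaum[OF assms(1)] by blast
  then interpret lindenbaum v .
  have "v \<phi> = \<one>\<^bsub>alg\<^esub>"
    using assms(2) fma_valuation_alg unfolding fma_valid_def by blast
  then show ?thesis
    by (rule v_eq_one_imp_MP)
qed

end
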